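(* Let $n \geq 2$ be an integer. For every integer $d \geq 1$, $$ N_{n,d} = \sum_{k=1}^d (-1)^{d-k} \binom{n}{d-k} \Delta_n(k), $$ where $$ \Delta_n(k) = \sum_{r|n} \mu \Big( \frac{n}{r} \Big) \Big(\sum_{j=0}^{r-1} k^j \Big) $$ and $\mu$ is the Möbius function.
   Context: $\mathscr{S}_n$ is the group of all permutations of $\{1,\ldots,n\}$ and $\mathscr{C}_n \subset \mathscr{S}_n$ is the set of all $n$-cycles. For $\nu \in \mathscr{S}_n$ the degree (also called cyclic descent number) is $\deg(\nu) = \#\{ i : \nu(i) > \nu(i+1)\}$, where $i$ ranges over $\{1,\ldots,n\}$ taken modulo $n$, so that $i=n$ is counted exactly when $\nu(n)>\nu(1)$. $N_{n,d}$ denotes the number of $\nu \in \mathscr{C}_n$ with $\deg(\nu)=d$. The sum over $r|n$ is over positive divisors $r$ of $n$, and $\binom{n}{m}=0$ when $m>n$. *)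

theory Defs
  imports Complex_Main "HOL-Combinatorics.Orbits" "HOL-Computational_Algebra.Squarefree"
begin

definition n_cycles :: "nat \<Rightarrow> (nat \<Rightarrow> nat) set" where
  "n_cycles n = {\<nu>. \<nu> permutes {1..n} \<and> cyclic_on \<nu> {1..n}}"

text \<open>The cyclic successor of \<open>i \<in> {1..n}\<close> is \<open>i mod n + 1\<close>; in particular that of \<open>n\<close> is \<open>1\<close>.\<close>

definition cyc_deg :: "nat \<Rightarrow> (nat \<Rightarrow> nat) \<Rightarrow> nat" where
  "cyc_deg n \<nu> = card {i \<in> {1..n}. \<nu> i > \<nu> (i mod n + 1)}"

definition num_cycles_deg :: "nat \<Rightarrow> nat \<Rightarrow> nat" where
  "num_cycles_deg n d = card {\<nu> \<in> n_cycles n. cyc_deg n \<nu> = d}"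

definition moebius_mu :: "nat \<Rightarrow> int" where
  "moebius_mu n = (if squarefree n then (- 1) ^ card (prime_factors n) else 0)"

definition Delta :: "nat \<Rightarrow> nat \<Rightarrow> int" where
  "Delta n k = (\<Sum>r | r dvd n. moebius_mu (n div r) * (\<Sum>j<r. int k ^ j))"

end

theory Submission
  imports Defs "HOL-Computational_Algebra.Formal_Power_Series"
begin

text \<open>
Fix \<open>k \<ge> 1\<close> and consider the strictly increasing functions \<open>f\<close> on the integers with
\<open>f (i + n) = f i + k n\<close> that induce an \<open>n\<close>-cycle on the residues modulo \<open>n\<close>, normalised by
\<open>0 \<le> f 0 < n\<close>. The theorem comes from counting these lifts in two ways.

Sorted by the cycle \<open>\<nu>\<close> that they induce: a lift of \<open>\<nu>\<close> is given by the number of times it wraps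
around between consecutive arguments. Each cyclic descent forces one wrap and there are \<open>k\<close> wraps
in total, so the lifts of \<open>\<nu>\<close> correspond to lists of \<open>n\<close> naturals with sum \<open>k - cyc_deg n \<nu>\<close>
(\<open>n_cycle.card_lifts_over\<close>).

Sorted by the integer \<open>X = f\<^sup>n(0) / n\<close>, here called the rotation number: write
\<open>[m] = 1 + k + \<dots> + k\<^sup>m\<^sup>-\<^sup>1\<close>. The integers are the points \<open>f\<^sup>m(0) + n t\<close>, and sending such a point to \<open>X [m] + [n] t\<close> is a well-defined and
strictly increasing map that turns \<open>f\<close> into \<open>y \<mapsto> k y + X\<close> (\<open>cyclic_lift.coordinates\<close>). Hence \<open>X\<close>
determines \<open>f\<close>. The values that occur are the \<open>X\<close> in \<open>{0..<[n]}\<close> for which the orbit of \<open>0\<close> under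
\<open>y \<mapsto> k y + X\<close> has period exactly \<open>n\<close> modulo \<open>[n]\<close>. For a divisor \<open>r\<close> of \<open>n\<close>
there are \<open>[r]\<close> values whose period divides \<open>r\<close>, so Moebius inversion gives \<open>Delta n k\<close>
(\<open>card_primitive_rotations\<close>, \<open>card_cyclic_lifts\<close>).

Equating the counts expresses \<open>Delta n k\<close> as the convolution of the numbers of \<open>n\<close>-cycles of
degree \<open>d\<close> with the coefficients of \<open>1 / (1 - x) ^ n\<close> (\<open>Delta_eq_convolution\<close>). Multiplying the
generating functions by \<open>(1 - x) ^ n\<close> solves for the former.
\<close>

section \<open>Counting primitive rotation numbers\<close>

text \<open>
The base-\<open>k\<close> repunit \<open>(k ^ m - 1) / (k - 1)\<close>. Written as a sum it also makes sense for
\<open>k = 1\<close>, where it equals \<open>m\<close>; this lets the cases \<open>k = 1\<close> and \<open>k \<ge> 2\<close> be counted together.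
\<close>

definition repunit :: "nat \<Rightarrow> nat \<Rightarrow> int" where
  "repunit k m = (\<Sum>j<m. int k ^ j)"

lemma repunit_0 [simp]: "repunit k 0 = 0"
  by (simp add: repunit_def)

lemma repunit_Suc: "repunit k (Suc m) = 1 + int k * repunit k m"
  by (simp add: repunit_def sum.lessThan_Suc_shift sum_distrib_left del: sum.lessThan_Suc)

lemma repunit_add: "repunit k (m + l) = repunit k m + int k ^ m * repunit k l"
  by (induction m) (simp_all add: repunit_Suc algebra_simps)

lemma repunit_geometric: "(int k - 1) * repunit k m = int k ^ m - 1"
  by (induction m) (simp_all add: repunit_Suc algebra_simps)

lemma repunit_nonneg: "0 \<le> repunit k m"
  by (simp add: repunit_def sum_nonneg)

lemma repunit_pos: "0 < m \<Longrightarrow> 0 < repunit k m"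
  by (cases m) (simp_all add: repunit_Suc repunit_nonneg add_pos_nonneg)

lemma repunit_dvd_mult: "repunit k r dvd repunit k (r * c)"
  by (induction c) (simp_all add: repunit_add)

lemma repunit_dvd: "r dvd m \<Longrightarrow> repunit k r dvd repunit k m"
  using repunit_dvd_mult by (auto simp: dvd_def)

lemma moebius_mu_prime_mult:
  assumes "prime p" and "\<not> p dvd d"
  shows "moebius_mu (p * d) = - moebius_mu d"
proof -
  have cop: "coprime p d"
    using assms by (simp add: prime_imp_coprime)
  have sq: "squarefree (p * d) \<longleftrightarrow> squarefree d"
    using assms cop by (auto intro: squarefree_mult_coprime squarefree_prime dest: squarefree_multD)
  show ?thesis
  proof (cases "squarefree d")
    case True
    have "d \<noteq> 0" using assms(2) by (metis dvd_0_right)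
    with assms have "prime_factors (p * d) = insert p (prime_factors d)"
      by (simp add: prime_factors_product prime_prime_factors)
    moreover have "p \<notin> prime_factors d"
      using assms by auto
    ultimately show ?thesis
      using True sq by (simp add: moebius_mu_def)
  qed (use sq in \<open>simp add: moebius_mu_def\<close>)
qed

text \<open>
Only squarefree divisors contribute. For a prime \<open>p\<close> dividing \<open>N\<close>, multiplication by \<open>p\<close> matches
those prime to \<open>p\<close> with those divisible by \<open>p\<close>, and the two members of a pair cancel.
\<close>

lemma sum_moebius_mu_divisors:
  assumes "N > 0"
  shows "(\<Sum>d | d dvd N. moebius_mu d) = (if N = 1 then 1 else 0)"
proof (cases "N = 1")
  case True
  then show ?thesis by (simp add: moebius_mu_def)
next
  case False
  then obtain p where p: "prime p" "p dvd N"
    using prime_factor_nat by blast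
  define A where "A = {d. d dvd N \<and> squarefree d \<and> \<not> p dvd d}"
  define B where "B = {d. d dvd N \<and> squarefree d \<and> p dvd d}"
  have fin: "finite {d. d dvd N}"
    using assms by simp
  have finA: "finite A" and finB: "finite B"
    by (rule finite_subset[OF _ fin]; auto simp: A_def B_def)+
  have pos: "p > 0" using p(1) prime_gt_0_nat by simp
  have bij: "bij_betw ((*) p) A B"
  proof (rule bij_betw_imageI)
    show "inj_on ((*) p) A" using pos by (auto simp: inj_on_def)
    show "(*) p ` A = B"
    proof (intro equalityI subsetI)
      fix x assume "x \<in> (*) p ` A"
      then obtain d where d: "x = p * d" "d dvd N" "squarefree d" "\<not> p dvd d"
        by (auto simp: A_def)
      have cop: "coprime p d" using p d by (simp add: prime_imp_coprime)
      then show "x \<in> B"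
        using d p by (auto simp: B_def intro: divides_mult squarefree_mult_coprime squarefree_prime)
    next
      fix x assume x: "x \<in> B"
      then obtain d where d: "x = p * d" by (auto simp: B_def)
      have "\<not> p dvd d"
        using x p(1) unfolding B_def d squarefree_def
        by (metis (lifting) dvd_refl mem_Collect_eq mult_dvd_mono not_prime_unit power2_eq_square)
      then have "d \<in> A"
        using x unfolding B_def d A_def by (auto dest: squarefree_multD dvd_mult_right)
      then show "x \<in> (*) p ` A" using d by auto
    qed
  qed
  have "(\<Sum>d | d dvd N. moebius_mu d) = (\<Sum>d\<in>A \<union> B. moebius_mu d)"
    using fin by (intro sum.mono_neutral_right) (auto simp: A_def B_def moebius_mu_def)
  also have "\<dots> = (\<Sum>d\<in>A. moebius_mu d) + (\<Sum>d\<in>B. moebius_mu d)"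
    using finA finB by (intro sum.union_disjoint) (auto simp: A_def B_def)
  also have "(\<Sum>d\<in>B. moebius_mu d) = (\<Sum>d\<in>A. moebius_mu (p * d))"
    by (rule sum.reindex_bij_betw[OF bij, symmetric])
  also have "\<dots> = - (\<Sum>d\<in>A. moebius_mu d)"
    unfolding sum_negf[symmetric]
    by (intro sum.cong) (use p in \<open>auto simp: A_def moebius_mu_prime_mult\<close>)
  finally show ?thesis using False by simp
qed

lemma sum_moebius_mu_multiples:
  assumes "\<rho> dvd n" and "n > 0"
  shows "(\<Sum>r | r dvd n \<and> \<rho> dvd r. moebius_mu (n div r)) = (if \<rho> = n then 1 else 0)"
proof -
  from assms obtain N where N: "n = \<rho> * N" by auto
  with assms have pos: "N > 0" "\<rho> > 0" by auto
  have "(\<Sum>r | r dvd n \<and> \<rho> dvd r. moebius_mu (n div r)) = (\<Sum>e | e dvd N. moebius_mu e)"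
    by (rule sum.reindex_bij_witness[where i = "\<lambda>e. n div e" and j = "\<lambda>r. n div r"])
       (use N pos in \<open>auto simp: dvd_def\<close>)
  also have "\<dots> = (if \<rho> = n then 1 else 0)"
    using N pos by (simp add: sum_moebius_mu_divisors)
  finally show ?thesis .
qed

text \<open>
Because \<open>repunit k (m + l) = repunit k m + k ^ m * repunit k l\<close>, subtracting a multiple of one
admissible \<open>r\<close> from another leaves an admissible remainder, so the admissible \<open>r\<close> are exactly
the multiples of the least positive one. Dynamically, \<open>X * repunit k r\<close> is the \<open>r\<close>-th iterate
of \<open>0\<close> under \<open>y \<mapsto> k * y + X\<close>, and \<open>\<rho>\<close> is the period of \<open>0\<close> modulo \<open>repunit k n\<close>.
\<close>

lemma repunit_period:
  assumes "n > 0"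
  obtains \<rho> where "\<rho> > 0" "\<And>r. repunit k n dvd X * repunit k r \<longleftrightarrow> \<rho> dvd r"
proof -
  define P where "P r \<longleftrightarrow> 0 < r \<and> repunit k n dvd X * repunit k r" for r
  define \<rho> where "\<rho> = (LEAST r. P r)"
  have "P n" using assms by (simp add: P_def)
  then have \<rho>: "P \<rho>" unfolding \<rho>_def by (rule LeastI)
  have "repunit k n dvd X * repunit k r \<longleftrightarrow> \<rho> dvd r" for r
  proof -
    have mult: "repunit k n dvd X * repunit k (\<rho> * c)" for c
      using \<rho> repunit_dvd_mult by (meson P_def dvd_trans mult_dvd_mono dvd_refl)
    have "X * repunit k r = X * repunit k (r mod \<rho>)
        + int k ^ (r mod \<rho>) * (X * repunit k (\<rho> * (r div \<rho>)))"
      using repunit_add[of k "r mod \<rho>" "\<rho> * (r div \<rho>)"] by (simp add: algebra_simps)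
    with mult[of "r div \<rho>"] have "repunit k n dvd X * repunit k r \<longleftrightarrow> repunit k n dvd X * repunit k (r mod \<rho>)"
      by (metis dvd_add_left_iff dvd_mult)
    also have "\<dots> \<longleftrightarrow> r mod \<rho> = 0"
    proof
      assume "repunit k n dvd X * repunit k (r mod \<rho>)"
      moreover have "\<not> P (r mod \<rho>)"
        using \<rho> not_less_Least[of "r mod \<rho>" P] mod_less_divisor[of \<rho> r]
        unfolding \<rho>_def[symmetric] by (auto simp: P_def)
      ultimately show "r mod \<rho> = 0" by (simp add: P_def)
    qed simp
    finally show ?thesis by (simp add: dvd_eq_mod_eq_0)
  qed
  with \<rho> show ?thesis by (intro that) (auto simp: P_def)
qed

lemma card_multiples:
  fixes c q :: int
  assumes "c > 0" "q \<ge> 0"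
  shows "int (card {x \<in> {0..<q * c}. c dvd x}) = q"
proof -
  have "bij_betw (\<lambda>y. y * c) {0..<q} {x \<in> {0..<q * c}. c dvd x}"
    by (rule bij_betw_byWitness[where f' = "\<lambda>x. x div c"])
       (use assms in \<open>auto simp: zero_le_mult_iff\<close>)
  from bij_betw_same_card[OF this] show ?thesis using assms by simp
qed

text \<open>
As \<open>X * repunit k r\<close> is the \<open>r\<close>-th iterate of \<open>0\<close> under \<open>y \<mapsto> k * y + X\<close>, membership says that
modulo \<open>repunit k n\<close> the orbit of \<open>0\<close> closes up after \<open>n\<close> steps and not earlier.
\<close>

definition primitive_rotations :: "nat \<Rightarrow> nat \<Rightarrow> int set" where
  "primitive_rotations n k = {X \<in> {0..<repunit k n}. \<forall>r. 0 < r \<and> r < n \<longrightarrow> \<not> repunit k n dvd X * repunit k r}"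

text \<open>
Moebius inversion over the possible periods. If \<open>r\<close> divides \<open>n\<close>, the \<open>X\<close> whose period divides \<open>r\<close>
are the multiples of \<open>repunit k n / repunit k r\<close>, and \<open>repunit k r\<close> of them lie in
\<open>{0..<repunit k n}\<close>. Weighting with \<open>moebius_mu (n div r)\<close> keeps exactly the \<open>X\<close> of period \<open>n\<close>.
\<close>

theorem card_primitive_rotations:
  assumes "n > 0"
  shows "int (card (primitive_rotations n k)) = Delta n k"
proof -
  let ?q = "repunit k" and ?I = "{0..<repunit k n}"
  have fin: "finite {r. r dvd n}" using assms by simp
  have count: "int (card {X \<in> ?I. ?q n dvd X * ?q r}) = ?q r" if r: "r dvd n" for r
  proof -
    have r0: "r > 0" using r assms by (rule dvd_pos_nat[rotated])
    obtain c where c: "?q n = ?q r * c" using repunit_dvd[OF r] by (auto simp: dvd_def)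
    have "c > 0" using repunit_pos[OF assms, of k] repunit_pos[OF r0, of k] c
      by (simp add: zero_less_mult_iff)
    have "{X \<in> ?I. ?q n dvd X * ?q r} = {x \<in> {0..<?q r * c}. c dvd x}"
      using repunit_pos[OF r0, of k] by (simp add: c mult.commute[of "?q r"])
    with card_multiples[OF \<open>c > 0\<close> repunit_nonneg] show ?thesis by simp
  qed
  have single: "(\<Sum>r | r dvd n. if ?q n dvd X * ?q r then moebius_mu (n div r) else 0)
      = (if X \<in> primitive_rotations n k then 1 else 0)" if "X \<in> ?I" for X
  proof -
    obtain \<rho> where \<rho>: "\<rho> > 0" "\<And>r. ?q n dvd X * ?q r \<longleftrightarrow> \<rho> dvd r"
      using repunit_period[OF assms] by blast
    have dvd: "\<rho> dvd n" using \<rho>(2)[of n] by simp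
    have "(\<Sum>r | r dvd n. if ?q n dvd X * ?q r then moebius_mu (n div r) else 0)
        = (\<Sum>r | r dvd n \<and> \<rho> dvd r. moebius_mu (n div r))"
      using fin by (simp add: \<rho>(2) sum.If_cases Int_def)
    also have "\<dots> = (if \<rho> = n then 1 else 0)"
      using dvd assms by (rule sum_moebius_mu_multiples)
    also have "\<rho> = n \<longleftrightarrow> X \<in> primitive_rotations n k"
      using that \<rho>(1) dvd_imp_le[OF dvd assms]
      by (auto simp: primitive_rotations_def \<rho>(2) dest: nat_dvd_not_less le_neq_implies_less)
    finally show ?thesis .
  qed
  have "int (card (primitive_rotations n k)) = (\<Sum>X\<in>?I. if X \<in> primitive_rotations n k then 1 else 0)"
    by (simp add: sum.If_cases primitive_rotations_def Int_def)
  also have "\<dots> = (\<Sum>X\<in>?I. \<Sum>r | r dvd n. if ?q n dvd X * ?q r then moebius_mu (n div r) else 0)"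
    by (intro sum.cong) (simp_all add: single)
  also have "\<dots> = (\<Sum>r | r dvd n. \<Sum>X\<in>?I. if ?q n dvd X * ?q r then moebius_mu (n div r) else 0)"
    by (rule sum.swap)
  also have "\<dots> = (\<Sum>r | r dvd n. moebius_mu (n div r) * int (card {X \<in> ?I. ?q n dvd X * ?q r}))"
    by (intro sum.cong) (simp_all add: sum.If_cases Int_def)
  also have "\<dots> = (\<Sum>r | r dvd n. moebius_mu (n div r) * ?q r)"
    by (intro sum.cong refl) (simp only: mem_Collect_eq count)
  finally show ?thesis by (simp add: Delta_def repunit_def)
qed

section \<open>Increasing lifts of n-cycles and their rotation numbers\<close>

lemma strict_mono_int_iff_step:
  fixes f :: "int \<Rightarrow> 'a::order"
  shows "strict_mono f \<longleftrightarrow> (\<forall>i. f i < f (i + 1))"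
proof
  assume step: "\<forall>i. f i < f (i + 1)"
  have "f i < f (i + 1 + int d)" for i d
  proof (induction d)
    case (Suc d)
    then show ?case using step[rule_format, of "i + 1 + int d"] by (simp add: add.assoc add.commute less_trans)
  qed (use step in simp)
  then show "strict_mono f"
    by (intro strict_monoI) (metis add.assoc add.commute zless_iff_Suc_zadd of_nat_Suc)
qed (simp add: strict_mono_def)

lemma strict_mono_int_expanding:
  fixes f :: "int \<Rightarrow> int"
  assumes "strict_mono f" "i \<le> j"
  shows "j - i \<le> f j - f i"
  using assms(2)
proof (induction j rule: int_ge_induct)
  case (step j)
  have "f j < f (j + 1)" using assms(1) by (simp add: strict_mono_def)
  with step show ?case by simp
qed simp

text \<open>
An increasing enumeration of a set of integers by the integers is determined by its value at \<open>0\<close>: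
the successor and the predecessor of an element within the set do not depend on the enumeration.
\<close>

lemma strict_mono_int_unique:
  fixes f g :: "int \<Rightarrow> int"
  assumes f: "strict_mono f" and g: "strict_mono g" and range: "range f = range g" and zero: "f 0 = g 0"
  shows "f = g"
proof
  fix i
  have step: "h (j + 1) \<le> h' (j' + 1)"
    if h: "strict_mono h" "strict_mono h'" "range h = range h'" "h j = h' j'" for h h' :: "int \<Rightarrow> int" and j j'
  proof -
    obtain l where l: "h' (j' + 1) = h l" using h(3) by (metis rangeE rangeI)
    have "h j < h l" using h l by (metis less_add_one strict_mono_less)
    then have "j + 1 \<le> l" using h(1) by (simp add: strict_mono_less)
    then show ?thesis using h(1) l by (simp add: strict_mono_less_eq)
  qed
  have step': "h' (j' - 1) \<le> h (j - 1)"
    if h: "strict_mono h" "strict_mono h'" "range h = range h'" "h j = h' j'" for h h' :: "int \<Rightarrow> int" and j j'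
  proof -
    obtain l where l: "h' (j' - 1) = h l" using h(3) by (metis rangeE rangeI)
    have "h l < h j" using h l by (metis diff_less_eq less_add_one strict_mono_less)
    then have "l \<le> j - 1" using h(1) by (simp add: strict_mono_less)
    then show ?thesis using h(1) l by (simp add: strict_mono_less_eq)
  qed
  show "f i = g i"
  proof (induction i rule: int_induct[where k = 0])
    case base show ?case by (rule zero)
  next
    case (step1 i)
    show ?case using step[OF f g range step1(2)] step[OF g f range[symmetric] step1(2)[symmetric]] by simp
  next
    case (step2 i)
    show ?case using step'[OF f g range step2(2)] step'[OF g f range[symmetric] step2(2)[symmetric]] by simp
  qed
qed

text \<open>
The integers cover a circle with \<open>n\<close> marked points, and \<open>f\<close> is the lift of an orientation
preserving map of degree \<open>k\<close> of these points.
\<close>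

locale degree_lift =
  fixes n k :: nat and f :: "int \<Rightarrow> int"
  assumes n_pos: "0 < n" and k_pos: "0 < k"
    and mono: "strict_mono f"
    and period: "f (i + int n) = f i + int k * int n"
begin

lemma shift: "f (i + int n * t) = f i + int k * int n * t"
proof (induction t rule: int_induct[where k = 0])
  case (step1 t)
  then show ?case using period[of "i + int n * t"] by (simp add: algebra_simps)
next
  case (step2 t)
  then show ?case using period[of "i + int n * (t - 1)"] by (simp add: algebra_simps)
qed simp

lemma funpow_shift: "(f ^^ m) (i + int n * t) = (f ^^ m) i + int k ^ m * int n * t"
proof (induction m)
  case (Suc m)
  have "(f ^^ Suc m) (i + int n * t) = f ((f ^^ m) i + int n * (int k ^ m * t))"
    by (simp add: Suc mult.left_commute mult.assoc)
  also have "\<dots> = f ((f ^^ m) i) + int k * int n * (int k ^ m * t)" by (rule shift)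
  finally show ?case by (simp add: algebra_simps)
qed simp

lemma funpow_mono: "strict_mono (f ^^ m)"
  by (induction m) (use mono in \<open>auto simp: strict_mono_def\<close>)

end

text \<open>
The map induced on residues modulo \<open>n\<close> is a single \<open>n\<close>-cycle, expressed by the first return time
of the residue \<open>0\<close>.
\<close>

locale cyclic_lift = degree_lift +
  assumes cycle: "int n dvd (f ^^ n) 0"
    and primitive: "0 < m \<Longrightarrow> m < n \<Longrightarrow> \<not> int n dvd (f ^^ m) 0"
begin

text \<open>
If two of the first \<open>n\<close> points of the orbit of \<open>0\<close> agreed modulo \<open>n\<close>, pushing both forward until
the later one reaches time \<open>n\<close> would give a return to the residue \<open>0\<close> before time \<open>n\<close>.
So these points meet \<open>n\<close> residues, that is, all of them.
\<close>

lemma orbit_residues: "\<exists>m<n. \<exists>t. i = (f ^^ m) 0 + int n * t"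
proof -
  define r where "r m = (f ^^ m) 0 mod int n" for m
  have distinct: "r a \<noteq> r b" if "a < b" "b < n" for a b
  proof
    assume "r a = r b"
    then have "int n dvd (f ^^ b) 0 - (f ^^ a) 0"
      unfolding r_def using mod_eq_dvd_iff[of "(f ^^ b) 0" "int n" "(f ^^ a) 0"] by simp
    then obtain t where "(f ^^ b) 0 - (f ^^ a) 0 = int n * t"
      by (auto simp: dvd_def)
    then have t: "(f ^^ b) 0 = (f ^^ a) 0 + int n * t" by simp
    have "(f ^^ n) 0 = (f ^^ (n - b)) ((f ^^ b) 0)"
      using that by (metis funpow_add le_add_diff_inverse2 less_imp_le o_apply)
    also have "\<dots> = (f ^^ (n - b)) ((f ^^ a) 0) + int k ^ (n - b) * int n * t"
      by (simp add: t funpow_shift)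
    also have "(f ^^ (n - b)) ((f ^^ a) 0) = (f ^^ (n - b + a)) 0"
      by (simp add: funpow_add)
    finally have "int n dvd (f ^^ (n - b + a)) 0"
      using cycle by (metis dvd_add_left_iff dvd_mult dvd_mult2 dvd_refl)
    moreover have "0 < n - b + a" "n - b + a < n" using that by auto
    ultimately show False using primitive[of "n - b + a"] by simp
  qed
  then have "inj_on r {..<n}"
    by (metis inj_onI lessThan_iff linorder_neqE_nat)
  moreover have "r ` {..<n} \<subseteq> {0..<int n}"
    using n_pos by (auto simp: r_def)
  ultimately have "r ` {..<n} = {0..<int n}"
    by (intro card_subset_eq) (simp_all add: card_image)
  moreover have "i mod int n \<in> {0..<int n}" using n_pos by simp
  ultimately obtain m where m: "m < n" "i mod int n = (f ^^ m) 0 mod int n"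
    by (metis (no_types, lifting) imageE lessThan_iff r_def)
  from m(2) obtain t where "i - (f ^^ m) 0 = int n * t"
    unfolding mod_eq_dvd_iff by (auto simp: dvd_def)
  then have "i = (f ^^ m) 0 + int n * t" by simp
  with m show ?thesis by blast
qed

text \<open>
The heart of the count: up to an increasing change of coordinate \<open>Y\<close>, the lift \<open>f\<close> is the affine
map \<open>y \<mapsto> k * y + X\<close> with \<open>X = f\<^sup>n(0) / n\<close>, with translation by \<open>n\<close> turned into translation by
\<open>repunit k n\<close>. In particular the order of the points \<open>f\<^sup>m(0) + n t\<close> depends on \<open>X\<close> only.

For \<open>k = 1\<close> the function \<open>f\<close> is itself a translation. For \<open>k \<ge> 2\<close> the displacement
\<open>f\<^sup>n(i) - i\<close> is nondecreasing in \<open>i\<close>, because an increasing integer function expands distances,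
and it is an affine function of the desired coordinate; solving for that coordinate defines \<open>Y\<close>.
Were \<open>Y\<close> not strictly increasing, \<open>f\<close> would commute with a translation by some \<open>p > 0\<close>, which
contradicts degree \<open>k \<ge> 2\<close>.
\<close>

lemma coordinates:
  obtains Y :: "int \<Rightarrow> int" where "strict_mono Y"
    "\<And>m t. Y ((f ^^ m) 0 + int n * t) = (f ^^ n) 0 div int n * repunit k m + repunit k n * t"
proof (cases "k = 1")
  case True
  have const: "f i = i + f 0" for i
  proof -
    (* The displacement f i - i is periodic and nondecreasing, hence constant. *)
    have p: "f (z + int n * t) - (z + int n * t) = f z - z" for z t
      using shift[of z t] True by simp
    have W: "f x - x \<le> f y - y" if "x \<le> y" for x y
      using strict_mono_int_expanding[OF mono that] by simp
    have "\<bar>i\<bar> \<le> int n * \<bar>i\<bar>"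
      using n_pos mult_right_mono[of 1 "int n" "\<bar>i\<bar>"] by simp
    then have bounds: "i \<le> 0 + int n * \<bar>i\<bar>" "0 + int n * (- \<bar>i\<bar>) \<le> i"
      unfolding mult_minus_right by linarith+
    show ?thesis using W[OF bounds(1)] W[OF bounds(2)] unfolding p by simp
  qed
  have pow: "(f ^^ m) 0 = int m * f 0" for m
    by (induction m) (simp, subst const, simp add: const[of "int _ * _"] algebra_simps)
  have "repunit k m = int m" for m
    using True by (simp add: repunit_def)
  then show ?thesis
    using n_pos by (intro that[of "\<lambda>i. i"]) (simp_all add: strict_mono_def pow)
next
  case False
  then have k2: "1 < int k" using k_pos by simp
  define X where "X = (f ^^ n) 0 div int n"
  have X: "(f ^^ n) 0 = int n * X" using cycle by (simp add: X_def)
  define Y where "Y i = (((f ^^ n) i - i) div int n - X) div (int k - 1)" for i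
  have displacement: "(f ^^ n) ((f ^^ m) 0 + int n * t) - ((f ^^ m) 0 + int n * t)
      = int n * (X + (int k - 1) * (X * repunit k m + repunit k n * t))" for m t
  proof -
    have "(f ^^ n) ((f ^^ m) 0) = (f ^^ m) ((f ^^ n) 0)"
      by (metis add.commute funpow_add o_apply)
    also have "\<dots> = (f ^^ m) 0 + int k ^ m * int n * X"
      using funpow_shift[of m 0 X] by (simp add: X)
    finally have "(f ^^ n) ((f ^^ m) 0 + int n * t) - ((f ^^ m) 0 + int n * t)
        = int n * (int k ^ m * X + (int k ^ n - 1) * t)"
      by (simp only: funpow_shift) (simp add: algebra_simps)
    also have "int k ^ m = (int k - 1) * repunit k m + 1"
      by (simp add: repunit_geometric)
    also have "int k ^ n - 1 = (int k - 1) * repunit k n"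
      by (simp add: repunit_geometric)
    finally show ?thesis by (simp add: algebra_simps)
  qed
  have Y: "Y ((f ^^ m) 0 + int n * t) = X * repunit k m + repunit k n * t" for m t
    unfolding Y_def displacement using n_pos k2 by simp
  have Y0: "Y 0 = 0" using Y[of 0 0] by simp
  have disp: "(f ^^ n) i - i = int n * (X + (int k - 1) * Y i)" for i
    using orbit_residues[of i] displacement Y by metis
  have Y_shift: "Y (i + int n * t) = Y i + repunit k n * t" for i t
  proof -
    obtain m s where i: "i = (f ^^ m) 0 + int n * s" using orbit_residues by blast
    have "i + int n * t = (f ^^ m) 0 + int n * (s + t)" by (simp add: i algebra_simps)
    then have "Y (i + int n * t) = X * repunit k m + repunit k n * (s + t)" by (simp only: Y)
    moreover have "Y i = X * repunit k m + repunit k n * s" by (simp only: i Y)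
    ultimately show ?thesis by (simp add: algebra_simps)
  qed
  have Y_f: "Y (f i) = int k * Y i + X" for i
  proof -
    obtain m s where i: "i = (f ^^ m) 0 + int n * s" using orbit_residues by blast
    have "f i = (f ^^ Suc m) 0 + int n * (int k * s)" by (simp add: i shift)
    then have "Y (f i) = X * repunit k (Suc m) + repunit k n * (int k * s)" by (simp only: Y)
    moreover have "Y i = X * repunit k m + repunit k n * s" by (simp only: i Y)
    ultimately show ?thesis by (simp add: repunit_Suc algebra_simps)
  qed
  have Y_mono: "Y i \<le> Y j" if "i \<le> j" for i j
  proof -
    have "(f ^^ n) i - i \<le> (f ^^ n) j - j"
      using strict_mono_int_expanding[OF funpow_mono[of n] that] by simp
    then show ?thesis using n_pos k2 by (simp add: disp)
  qed
  have no_zero: "Y p \<noteq> 0" if p: "0 < p" for p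
  proof
    assume "Y p = 0"
    (* Y p = Y 0 makes the distance d between the two orbits periodic in time; as f expands
       distances, d is constant, so f commutes with translation by p on every residue. *)
    define d where "d m = (f ^^ m) p - (f ^^ m) 0" for m
    have "Y ((f ^^ m) p) = Y ((f ^^ m) 0)" for m
      by (induction m) (simp_all add: \<open>Y p = 0\<close> Y0 Y_f)
    then have same: "(f ^^ n) ((f ^^ m) p) - (f ^^ m) p = (f ^^ n) ((f ^^ m) 0) - (f ^^ m) 0" for m
      by (simp only: disp)
    have d_per: "d (n + m) = d m" for m
      using same[of m] by (simp add: d_def funpow_add)
    have "0 < d m" for m
      using p funpow_mono[of m] by (simp add: d_def strict_mono_def)
    then have d_Suc: "d m \<le> d (Suc m)" for m
      using strict_mono_int_expanding[OF mono, of "(f ^^ m) 0" "(f ^^ m) p"]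
      by (simp add: d_def less_imp_le)
    have d_mono: "d a \<le> d b" if "a \<le> b" for a b
      using d_Suc that by (rule lift_Suc_mono_le)
    have d_const: "d m = p" for m
    proof (induction m)
      case (Suc m)
      have "d (Suc m) \<le> d (n + m)" by (rule d_mono) (use n_pos in simp)
      with d_Suc[of m] d_per[of m] Suc show ?case by simp
    qed (simp add: d_def)
    have f_p: "f (z + p) = f z + p" for z
    proof -
      obtain m s where z: "z = (f ^^ m) 0 + int n * s" using orbit_residues by blast
      have "z + p = (f ^^ m) p + int n * s" using d_const[of m] by (simp add: z d_def)
      then have "f (z + p) = (f ^^ Suc m) p + int k * int n * s" by (simp add: shift)
      also have "\<dots> = (f ^^ Suc m) 0 + p + int k * int n * s"
        using d_const[of "Suc m"] by (simp add: d_def)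
      finally show ?thesis by (simp add: z shift)
    qed
    have "f (int c * p) = f 0 + int c * p" for c
      by (induction c) (simp, simp add: distrib_right add.commute[of p] f_p)
    (* Translating n p units: f shifts by k n p according to its degree, by n p according to f_p. *)
    from this[of n] shift[of 0 p] have "int k * (int n * p) = int n * p" by auto
    then show False using k2 n_pos p by simp
  qed
  have "strict_mono Y"
  proof (rule strict_monoI)
    fix i j :: int
    assume ij: "i < j"
    show "Y i < Y j"
    proof (rule ccontr)
      assume "\<not> Y i < Y j"
      then have eq: "Y i = Y j" using Y_mono[of i j] ij by simp
      obtain m s where m: "m < n" and i: "i = (f ^^ m) 0 + int n * s" using orbit_residues by blast
      (* Apply f until i reaches a multiple n u of n; subtracting n u moves the coincidence
         Y i = Y j to one of the form Y p = 0. *)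
      define u where "u = X + int k ^ (n - m) * s"
      have "(f ^^ (n - m)) i = (f ^^ (n - m)) ((f ^^ m) 0) + int k ^ (n - m) * int n * s"
        by (simp add: i funpow_shift)
      also have "(f ^^ (n - m)) ((f ^^ m) 0) = (f ^^ n) 0"
        using m by (metis funpow_add le_add_diff_inverse2 less_imp_le o_apply)
      finally have u: "(f ^^ (n - m)) i = int n * u"
        by (simp add: u_def X algebra_simps)
      define p where "p = (f ^^ (n - m)) j - int n * u"
      have "Y ((f ^^ l) i) = Y ((f ^^ l) j)" for l
        by (induction l) (simp_all add: eq Y_f)
      from this[of "n - m"] have "Y (int n * u) = Y (p + int n * u)"
        by (simp add: p_def u)
      then have "Y p = 0" using Y_shift[of 0 u] Y_shift[of p u] Y0 by simp
      moreover have "0 < p"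
        using strict_monoD[OF funpow_mono[of "n - m"] ij] by (simp add: p_def u)
      ultimately show False using no_zero[of p] by simp
    qed
  qed
  with Y show ?thesis by (intro that[of Y]) (simp_all add: X_def)
qed

end

text \<open>
Adding a multiple of \<open>n\<close> to a lift does not change the induced map on residues; the bounds on
\<open>f 0\<close> select one lift from each such class.
\<close>

definition cyclic_lifts :: "nat \<Rightarrow> nat \<Rightarrow> (int \<Rightarrow> int) set" where
  "cyclic_lifts n k = {f. cyclic_lift n k f \<and> 0 \<le> f 0 \<and> f 0 < int n}"

text \<open>
In the coordinate \<open>Y\<close> the points \<open>0\<close>, \<open>f 0\<close>, \<open>n\<close> become \<open>0\<close>, \<open>X\<close>, \<open>repunit k n\<close>, so the
normalisations on both sides agree; and a premature return of \<open>X * repunit k r\<close> modulo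
\<open>repunit k n\<close> would be a premature return of \<open>f\<^sup>r(0)\<close> modulo \<open>n\<close>.
\<close>

lemma rotation_number_in:
  assumes f: "f \<in> cyclic_lifts n k"
  shows "(f ^^ n) 0 div int n \<in> primitive_rotations n k"
proof -
  interpret cyclic_lift n k f using f by (simp add: cyclic_lifts_def)
  obtain Y where mono_Y: "strict_mono Y"
    and Y: "\<And>m t. Y ((f ^^ m) 0 + int n * t) = (f ^^ n) 0 div int n * repunit k m + repunit k n * t"
    using coordinates by blast
  let ?X = "(f ^^ n) 0 div int n"
  have Y_f0: "Y (f 0) = ?X" using Y[of 1 0] by (simp add: repunit_def)
  have Y_n: "Y (int n * t) = repunit k n * t" for t using Y[of 0 t] by simp
  have "0 \<le> ?X" "?X < repunit k n"
    using f Y_f0 Y_n[of 0] Y_n[of 1] strict_mono_less_eq[OF mono_Y, of 0 "f 0"] strict_mono_less[OF mono_Y, of "f 0" "int n"]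
    by (simp_all add: cyclic_lifts_def)
  moreover have "\<not> repunit k n dvd ?X * repunit k r" if "0 < r" "r < n" for r
  proof
    assume "repunit k n dvd ?X * repunit k r"
    then obtain t where "?X * repunit k r = repunit k n * t" by (auto simp: dvd_def)
    then have "Y ((f ^^ r) 0) = Y (int n * t)" using Y[of r 0] Y_n by simp
    then have "(f ^^ r) 0 = int n * t" using mono_Y by (simp add: strict_mono_eq)
    then show False using primitive[OF that] by simp
  qed
  ultimately show ?thesis by (simp add: primitive_rotations_def)
qed

text \<open>
Two lifts with the same \<open>X\<close> have coordinates with the same range, hence the same coordinate, in
which both are the map \<open>y \<mapsto> k * y + X\<close>.
\<close>

lemma rotation_number_inj: "inj_on (\<lambda>f. (f ^^ n) 0 div int n) (cyclic_lifts n k)"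
proof (rule inj_onI)
  fix f g
  assume fg: "f \<in> cyclic_lifts n k" "g \<in> cyclic_lifts n k"
    and eq: "(f ^^ n) 0 div int n = (g ^^ n) 0 div int n"
  let ?X = "(f ^^ n) 0 div int n"
  interpret f: cyclic_lift n k f using fg by (simp add: cyclic_lifts_def)
  interpret g: cyclic_lift n k g using fg by (simp add: cyclic_lifts_def)
  obtain Yf where mono_f: "strict_mono Yf"
    and Yf: "\<And>m t. Yf ((f ^^ m) 0 + int n * t) = ?X * repunit k m + repunit k n * t"
    using f.coordinates by blast
  obtain Yg where mono_g: "strict_mono Yg"
    and Yg: "\<And>m t. Yg ((g ^^ m) 0 + int n * t) = ?X * repunit k m + repunit k n * t"
    using g.coordinates eq by metis
  have "range Yf = range Yg"
  proof (intro equalityI subsetI; elim rangeE)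
    fix y i assume "y = Yf i"
    then show "y \<in> range Yg" using f.orbit_residues[of i] Yf Yg by (metis rangeI)
  next
    fix y i assume "y = Yg i"
    then show "y \<in> range Yf" using g.orbit_residues[of i] Yf Yg by (metis rangeI)
  qed
  moreover have "Yf 0 = Yg 0" using Yf[of 0 0] Yg[of 0 0] by simp
  ultimately have Y_eq: "Yf = Yg" using mono_f mono_g strict_mono_int_unique by blast
  show "f = g"
  proof
    fix i
    obtain m t where i: "i = (f ^^ m) 0 + int n * t" using f.orbit_residues by blast
    obtain l s where i': "i = (g ^^ l) 0 + int n * s" using g.orbit_residues by blast
    have "Yf (f i) = int k * Yf i + ?X"
    proof -
      have "f i = (f ^^ Suc m) 0 + int n * (int k * t)" by (simp add: i f.shift)
      then have "Yf (f i) = ?X * repunit k (Suc m) + repunit k n * (int k * t)"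
        by (simp only: Yf)
      moreover have "Yf i = ?X * repunit k m + repunit k n * t"
        by (simp only: i Yf)
      ultimately show ?thesis by (simp add: repunit_Suc algebra_simps)
    qed
    moreover have "Yg (g i) = int k * Yg i + ?X"
    proof -
      have "g i = (g ^^ Suc l) 0 + int n * (int k * s)" by (simp add: i' g.shift)
      then have "Yg (g i) = ?X * repunit k (Suc l) + repunit k n * (int k * s)"
        by (simp only: Yg)
      moreover have "Yg i = ?X * repunit k l + repunit k n * s"
        by (simp only: i' Yg)
      ultimately show ?thesis by (simp add: repunit_Suc algebra_simps)
    qed
    ultimately have "Yf (f i) = Yf (g i)" by (simp add: Y_eq)
    then show "f i = g i" using mono_f by (simp add: strict_mono_eq)
  qed
qed

lemma enumerate_periodic_set:
  fixes q :: int
  assumes n: "0 < n" and q: "0 < q" and T: "T \<subseteq> {0..<q}" "card T = n" "0 \<in> T"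
  obtains Y :: "int \<Rightarrow> int" where "strict_mono Y" "Y 0 = 0" "\<And>i. Y (i + int n) = Y i + q"
    "range Y = {y. y mod q \<in> T}"
proof -
  have finT: "finite T" using T(1) finite_subset by blast
  define xs where "xs = sorted_list_of_set T"
  have xs: "sorted_wrt (<) xs" "set xs = T" "length xs = n"
    using finT T(2) by (simp_all add: xs_def)
  define Y where "Y i = xs ! nat (i mod int n) + q * (i div int n)" for i
  have in_T: "xs ! nat (i mod int n) \<in> T" for i
    using xs n by (metis nth_mem pos_mod_bound nat_less_iff of_nat_0_less_iff pos_mod_sign)
  have bound: "0 \<le> xs ! nat (i mod int n)" "xs ! nat (i mod int n) < q" for i
    using in_T[of i] T(1) by auto
  have "strict_mono Y"
  proof (rule strict_monoI)
    fix i j :: int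
    assume ij: "i < j"
    then have le: "i div int n \<le> j div int n" using n by (simp add: zdiv_mono1)
    show "Y i < Y j"
    proof (cases "i div int n = j div int n")
      case True
      with ij have "i mod int n < j mod int n"
        by (metis add_less_cancel_left mult_div_mod_eq)
      then have "nat (i mod int n) < nat (j mod int n)" "nat (j mod int n) < length xs"
        using n xs(3) pos_mod_sign[of "int n" i] pos_mod_bound[of "int n" j] by linarith+
      then show ?thesis using True xs(1) by (simp add: Y_def sorted_wrt_iff_nth_less)
    next
      case False
      with le have "i div int n + 1 \<le> j div int n" by simp
      then have "q * (i div int n + 1) \<le> q * (j div int n)" using q by (simp add: mult_left_mono)
      then show ?thesis using bound[of i] bound[of j] by (simp add: Y_def distrib_left)
    qed
  qed
  moreover have "Y 0 = 0"
  proof -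
    obtain a where a: "a < n" "xs ! a = 0" using T(3) xs by (metis in_set_conv_nth)
    have "xs ! 0 \<le> xs ! a"
      using sorted_wrt_nth_less[OF xs(1), of 0 a] a xs(3) by (cases "a = 0") auto
    then show ?thesis using a bound[of 0] by (simp add: Y_def)
  qed
  moreover have "Y (i + int n) = Y i + q" for i
    using n by (simp add: Y_def distrib_left)
  moreover have "range Y = {y. y mod q \<in> T}"
  proof (intro equalityI subsetI)
    fix y assume "y \<in> range Y"
    then obtain i where "y = Y i" by blast
    then have "y mod q = xs ! nat (i mod int n)" using bound[of i] by (simp add: Y_def)
    then show "y \<in> {y. y mod q \<in> T}" using in_T by simp
  next
    fix y assume "y \<in> {y. y mod q \<in> T}"
    then obtain a where a: "a < n" "xs ! a = y mod q" using xs by (metis in_set_conv_nth mem_Collect_eq)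
    have "Y (int a + int n * (y div q)) = y" using a n by (simp add: Y_def)
    then show "y \<in> range Y" by (metis rangeI)
  qed
  ultimately show ?thesis by (rule that)
qed

text \<open>
Given \<open>X\<close>, the set of all \<open>X * repunit k m + repunit k n * t\<close> is invariant under
\<open>y \<mapsto> k * y + X\<close> and has \<open>n\<close> elements in each period. Reading this map through the increasing
enumeration \<open>Y\<close> of the set gives the lift.
\<close>

lemma rotation_number_surj:
  assumes n: "0 < n" and k: "0 < k" and X: "X \<in> primitive_rotations n k"
  shows "\<exists>f \<in> cyclic_lifts n k. (f ^^ n) 0 div int n = X"
proof -
  let ?q = "repunit k n"
  have q: "0 < ?q" using n by (rule repunit_pos)
  have X_bounds: "0 \<le> X" "X < ?q" and X_prim: "\<And>r. 0 < r \<Longrightarrow> r < n \<Longrightarrow> \<not> ?q dvd X * repunit k r"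
    using X by (auto simp: primitive_rotations_def)
  define r where "r m = X * repunit k m mod ?q" for m
  have power_n: "int k ^ n = 1 + (int k - 1) * ?q"
    by (simp add: repunit_geometric)
  have r_add: "r (n + m) = r m" for m
  proof -
    have "X * repunit k (n + m) = X * repunit k m + ?q * (X + X * (int k - 1) * repunit k m)"
      by (subst repunit_add, simp only: power_n) (simp add: algebra_simps)
    then show ?thesis by (simp add: r_def)
  qed
  have distinct: "r a \<noteq> r b" if "a < b" "b < n" for a b
  proof
    assume "r a = r b"
    then have "?q dvd X * repunit k b - X * repunit k a"
      unfolding r_def using mod_eq_dvd_iff[of "X * repunit k b" ?q "X * repunit k a"] by simp
    (* Push both points forward by n - b steps, so that the later one returns to 0. *)
    then have "?q dvd int k ^ (n - b) * (X * repunit k b - X * repunit k a)" by simp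
    moreover have "int k ^ (n - b) * (X * repunit k b - X * repunit k a)
        = X * repunit k (n - b + b) - X * repunit k (n - b + a)"
      by (simp only: repunit_add) (simp add: algebra_simps)
    ultimately have "?q dvd X * ?q - X * repunit k (n - b + a)" using that by simp
    then have "?q dvd X * repunit k (n - b + a)"
      by (metis dvd_diff_right_iff dvd_triv_right)
    moreover have "0 < n - b + a" "n - b + a < n" using that by auto
    ultimately show False using X_prim[of "n - b + a"] by simp
  qed
  define T where "T = r ` {..<n}"
  have "inj_on r {..<n}"
    using distinct by (metis inj_onI lessThan_iff linorder_neqE_nat)
  then have "card T = n" by (simp add: T_def card_image)
  moreover have "T \<subseteq> {0..<?q}" using q by (auto simp: T_def r_def)
  moreover have "r 0 \<in> T" using n by (simp add: T_def)
  then have "0 \<in> T" by (simp add: r_def)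
  ultimately obtain Y where mono_Y: "strict_mono Y" and Y0: "Y 0 = 0"
    and Y_n: "\<And>i. Y (i + int n) = Y i + ?q" and range_Y: "range Y = {y. y mod ?q \<in> T}"
    using enumerate_periodic_set[OF n q] by metis
  have closed: "int k * y + X \<in> range Y" if "y \<in> range Y" for y
  proof -
    have "y mod ?q \<in> T" using that unfolding range_Y by simp
    then obtain m where m: "m < n" "y mod ?q = X * repunit k m mod ?q"
      by (auto simp: T_def r_def)
    have "(int k * y + X) mod ?q = (int k * (X * repunit k m) + X) mod ?q"
      by (intro mod_add_cong mod_mult_cong m(2) refl)
    also have "\<dots> = r (Suc m)" by (simp add: r_def repunit_Suc algebra_simps)
    also have "\<dots> \<in> T"
    proof (cases "Suc m = n")
      case True
      then show ?thesis using r_add[of 0] n by (simp add: T_def)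
    qed (use m in \<open>auto simp: T_def\<close>)
    finally show ?thesis by (simp add: range_Y)
  qed
  then have "\<exists>j. Y j = int k * Y i + X" for i
    by (metis rangeE rangeI)
  then obtain f where Y_f: "\<And>i. Y (f i) = int k * Y i + X" by metis
  have Y_shift: "Y (i + int n * t) = Y i + ?q * t" for i t
  proof (induction t rule: int_induct[where k = 0])
    case (step1 t)
    then show ?case using Y_n[of "i + int n * t"] by (simp add: algebra_simps)
  next
    case (step2 t)
    then show ?case using Y_n[of "i + int n * (t - 1)"] by (simp add: algebra_simps)
  qed simp
  have Y_inj: "Y i = Y j \<longleftrightarrow> i = j" for i j using mono_Y by (rule strict_mono_eq)
  have Y_less: "Y i < Y j \<longleftrightarrow> i < j" for i j using mono_Y by (rule strict_mono_less)
  have "f i < f (i + 1)" for i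
  proof -
    have "Y i < Y (i + 1)" by (simp add: Y_less)
    then have "Y (f i) < Y (f (i + 1))" using k by (simp add: Y_f)
    then show ?thesis by (simp only: Y_less)
  qed
  then have mono_f: "strict_mono f" by (simp add: strict_mono_int_iff_step)
  have period_f: "f (i + int n) = f i + int k * int n" for i
  proof -
    have "Y (f (i + int n)) = Y (f i + int n * int k)"
      unfolding Y_shift by (simp add: Y_f Y_n algebra_simps)
    then show ?thesis by (simp add: Y_inj mult.commute)
  qed
  have Y_pow: "Y ((f ^^ m) 0) = X * repunit k m" for m
    by (induction m) (simp_all add: Y0 Y_f repunit_Suc algebra_simps)
  have Y_mult: "Y (int n * t) = ?q * t" for t using Y_shift[of 0 t] Y0 by simp
  have f_n: "(f ^^ n) 0 = int n * X"
    by (rule iffD1[OF Y_inj]) (simp add: Y_pow Y_mult)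
  have "\<not> int n dvd (f ^^ m) 0" if "0 < m" "m < n" for m
  proof
    assume "int n dvd (f ^^ m) 0"
    then obtain t where "(f ^^ m) 0 = int n * t" by (auto simp: dvd_def)
    then have "X * repunit k m = ?q * t" using Y_pow[of m] Y_mult[of t] by simp
    then show False using X_prim[OF that] by simp
  qed
  with n k mono_f period_f f_n have "cyclic_lift n k f"
    by unfold_locales auto
  moreover have "0 \<le> f 0" "f 0 < int n"
    using X_bounds Y_pow[of 1] Y_mult[of 1] Y_less[of "f 0" 0] Y_less[of "f 0" "int n"] Y0
    by (auto simp: repunit_def not_less[symmetric])
  ultimately show ?thesis using f_n n by (intro bexI[of _ f]) (simp_all add: cyclic_lifts_def)
qed

theorem card_cyclic_lifts:
  assumes "0 < n" "0 < k"
  shows "int (card (cyclic_lifts n k)) = Delta n k"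
proof -
  have "bij_betw (\<lambda>f. (f ^^ n) 0 div int n) (cyclic_lifts n k) (primitive_rotations n k)"
    using rotation_number_inj rotation_number_in rotation_number_surj[OF assms]
    by (intro bij_betw_imageI) blast+
  then show ?thesis using card_primitive_rotations[OF assms(1)] by (simp add: bij_betw_same_card)
qed

section \<open>Lifts of a given n-cycle\<close>

text \<open>
The index \<open>i\<close> in \<open>{1..n}\<close> stands for the residue \<open>i - 1\<close>.
\<close>

definition residue_perm :: "nat \<Rightarrow> (int \<Rightarrow> int) \<Rightarrow> nat \<Rightarrow> nat" where
  "residue_perm n f i = (if i \<in> {1..n} then nat (f (int i - 1) mod int n) + 1 else i)"

text \<open>
Reduction modulo \<open>n\<close> intertwines \<open>f\<close> with \<open>\<nu>\<close>, so the return times of the residue \<open>0\<close> under \<open>f\<close> and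
of the index \<open>1\<close> under \<open>\<nu>\<close> are the same.
\<close>

lemma (in degree_lift) funpow_residue:
  assumes "\<And>j. j < n \<Longrightarrow> int (\<nu> (Suc j)) = f (int j) mod int n + 1"
  shows "int ((\<nu> ^^ m) 1) = (f ^^ m) 0 mod int n + 1"
proof (induction m)
  case (Suc m)
  define a where "a = nat ((f ^^ m) 0 mod int n)"
  have a: "a < n" "int a = (f ^^ m) 0 mod int n"
    using n_pos by (simp_all add: a_def nat_less_iff)
  have "(\<nu> ^^ m) 1 = Suc a" using Suc a by simp
  then have "int ((\<nu> ^^ Suc m) 1) = f (int a) mod int n + 1" using assms[OF a(1)] by simp
  also have "f (int a) mod int n = f (int a + int n * ((f ^^ m) 0 div int n)) mod int n"
    unfolding shift by (simp add: mult.assoc mult.left_commute[of "int k"])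
  also have "int a + int n * ((f ^^ m) 0 div int n) = (f ^^ m) 0"
    by (simp add: a(2))
  finally show ?case by simp
qed simp

lemma residue_perm_n_cycle:
  assumes "cyclic_lift n k f"
  shows "residue_perm n f \<in> n_cycles n"
proof -
  interpret cyclic_lift n k f by fact
  let ?\<nu> = "residue_perm n f"
  have pow: "int ((?\<nu> ^^ m) 1) = (f ^^ m) 0 mod int n + 1" for m
    by (rule funpow_residue) (use n_pos in \<open>simp add: residue_perm_def\<close>)
  have range: "(?\<nu> ^^ m) 1 \<in> {1..n}" for m
    using pow[of m] pos_mod_bound[of "int n" "(f ^^ m) 0"] pos_mod_sign[of "int n" "(f ^^ m) 0"] n_pos
    unfolding atLeastAtMost_iff by linarith
  have reach: "\<exists>m>0. i = (?\<nu> ^^ m) 1" if i: "i \<in> {1..n}" for i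
  proof -
    obtain m t where m: "int i - 1 = (f ^^ m) 0 + int n * t" using orbit_residues by blast
    obtain X where X: "(f ^^ n) 0 = int n * X" using cycle by (auto simp: dvd_def)
    have "(f ^^ (m + n)) 0 = (f ^^ m) 0 + int n * (int k ^ m * X)"
      using funpow_shift[of m 0 X] by (simp add: funpow_add X algebra_simps)
    then have "(f ^^ (m + n)) 0 mod int n = (int i - 1) mod int n"
      by (simp add: m)
    also have "\<dots> = int i - 1" using i by simp
    finally have "i = (?\<nu> ^^ (m + n)) 1" using pow[of "m + n"] by simp
    then show ?thesis using n_pos by (intro exI[of _ "m + n"]) simp
  qed
  have "{1..n} = orbit ?\<nu> 1"
    unfolding orbit_altdef using range reach by blast
  moreover have "1 \<in> {1..n}" using n_pos by simp
  ultimately have cyc: "cyclic_on ?\<nu> {1..n}" by (rule cyclic_on_singleI[rotated])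
  have "{1..n} \<subseteq> ?\<nu> ` {1..n}"
  proof
    fix i assume "i \<in> {1..n}"
    then obtain m where "0 < m" "i = (?\<nu> ^^ m) 1" using reach by blast
    then have "i = ?\<nu> ((?\<nu> ^^ (m - 1)) 1)" by (cases m) simp_all
    then show "i \<in> ?\<nu> ` {1..n}" using range by blast
  qed
  moreover have "?\<nu> ` {1..n} \<subseteq> {1..n}"
    using cyc cyclic_on_inI by fastforce
  ultimately have image: "?\<nu> ` {1..n} = {1..n}" by simp
  then have "inj_on ?\<nu> {1..n}" by (simp add: eq_card_imp_inj_on)
  with image have "?\<nu> permutes {1..n}"
    by (intro bij_imp_permutes) (auto simp: bij_betw_def residue_perm_def)
  with cyc show ?thesis by (simp add: n_cycles_def)
qed

lemma n_cycle_return: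
  assumes "\<nu> \<in> n_cycles n" "0 < n"
  shows "(\<nu> ^^ n) 1 = 1" "0 < m \<Longrightarrow> m < n \<Longrightarrow> (\<nu> ^^ m) 1 \<noteq> 1"
proof -
  have "orbit \<nu> 1 = {1..n}"
    using assms by (intro orbit_cyclic_eq3) (auto simp: n_cycles_def)
  moreover from this have self: "1 \<in> orbit \<nu> 1" using assms by simp
  moreover have "card (orbit \<nu> 1) = funpow_dist1 \<nu> 1 1"
    by (subst orbit_conv_funpow_dist1[OF self], subst card_image[OF inj_on_funpow_dist1[OF self]]) simp
  ultimately have "funpow_dist1 \<nu> 1 1 = n" by (metis card_atLeastAtMost diff_Suc_1)
  then show "(\<nu> ^^ n) 1 = 1" "0 < m \<Longrightarrow> m < n \<Longrightarrow> (\<nu> ^^ m) 1 \<noteq> 1"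
    using funpow_dist1_prop[OF self] funpow_dist1_least[of m \<nu> 1 1] by simp_all
qed

text \<open>
For a fixed \<open>n\<close>-cycle, a lift is determined by how often it wraps around modulo \<open>n\<close> between
consecutive arguments. It must wrap at least once at every cyclic descent, and a lift of degree
\<open>k\<close> wraps \<open>k\<close> times in one period. The wraps beyond the forced ones can be chosen freely, so
they form an arbitrary list of \<open>n\<close> naturals with sum \<open>k - cyc_deg n \<nu>\<close>.
\<close>

locale n_cycle =
  fixes n :: nat and \<nu> :: "nat \<Rightarrow> nat"
  assumes n_ge_2: "2 \<le> n" and cycle_perm: "\<nu> \<in> n_cycles n"
begin

text \<open>
The residue assigned to the residue \<open>j\<close>; reducing \<open>j\<close> makes the cyclic successor of \<open>j\<close> plainly
\<open>Suc j\<close>, also at the end of the period.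
\<close>

definition val :: "nat \<Rightarrow> int" where
  "val j = int (\<nu> (j mod n + 1)) - 1"

definition desc :: "nat \<Rightarrow> nat" where
  "desc j = of_bool (val (Suc j) < val j)"

lemma perm: "\<nu> permutes {1..n}"
  using cycle_perm by (simp add: n_cycles_def)

lemma val_bounds: "0 \<le> val j" "val j < int n"
proof -
  have "j mod n + 1 \<in> {1..n}" using n_ge_2 by (simp add: Suc_leI)
  then have "\<nu> (j mod n + 1) \<in> {1..n}" using permutes_in_image[OF perm] by blast
  then show "0 \<le> val j" "val j < int n" by (auto simp: val_def)
qed

lemma val_neq: "val (Suc j) \<noteq> val j"
proof
  assume "val (Suc j) = val j"
  then have "\<nu> (Suc j mod n + 1) = \<nu> (j mod n + 1)" by (simp add: val_def)
  then have "Suc j mod n + 1 = j mod n + 1" by (rule injD[OF permutes_inj[OF perm]])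
  then show False using n_ge_2 by (simp add: mod_Suc split: if_splits)
qed

lemma val_n: "val n = val 0"
  by (simp add: val_def)

lemma cyc_deg_eq: "cyc_deg n \<nu> = (\<Sum>j<n. desc j)"
proof -
  have "cyc_deg n \<nu> = (\<Sum>i\<in>{1..n}. of_bool (\<nu> (i mod n + 1) < \<nu> i))"
    by (simp add: cyc_deg_def sum.If_cases of_bool_def Int_def)
  also have "{1..n} = Suc ` {..<n}"
    by (simp add: image_Suc_lessThan)
  also have "(\<Sum>i\<in>Suc ` {..<n}. of_bool (\<nu> (i mod n + 1) < \<nu> i)) = (\<Sum>j<n. desc j)"
    unfolding sum.reindex[OF inj_Suc] o_def
    by (intro sum.cong) (auto simp: desc_def val_def)
  finally show ?thesis .
qed

text \<open>
The maximal value \<open>n\<close> is followed by a descent.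
\<close>

lemma cyc_deg_pos: "0 < cyc_deg n \<nu>"
proof -
  obtain i where i: "i \<in> {1..n}" "\<nu> i = n"
    using permutes_image[OF perm] n_ge_2 by (metis (no_types, lifting) atLeastAtMost_iff imageE le_refl one_le_numeral order_trans)
  define j where "j = i - 1"
  have "val j = int n - 1" "j < n"
    using i by (auto simp: val_def j_def)
  then have "desc j = 1"
    using val_bounds[of "Suc j"] val_neq[of j] by (simp add: desc_def)
  then have "0 < (\<Sum>j<n. desc j)"
    using \<open>j < n\<close> by (intro sum_pos2[of _ j]) auto
  then show ?thesis by (simp add: cyc_deg_eq)
qed

text \<open>
The number of wraps accumulated between \<open>0\<close> and \<open>j\<close>: the forced ones plus the additional ones in \<open>l\<close>.
\<close>

definition height :: "nat list \<Rightarrow> nat \<Rightarrow> int" where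
  "height l j = (\<Sum>i<j. int (l ! i + desc i))"

definition lift_of :: "nat \<Rightarrow> nat list \<Rightarrow> int \<Rightarrow> int" where
  "lift_of k l i = val (nat (i mod int n)) + int n * (height l (nat (i mod int n)) + int k * (i div int n))"

definition gaps :: "(int \<Rightarrow> int) \<Rightarrow> nat list" where
  "gaps f = map (\<lambda>j. nat (f (int (Suc j)) div int n - f (int j) div int n) - desc j) [0..<n]"

lemma lift_of_shift: "lift_of k l (i + int n * t) = lift_of k l i + int k * int n * t"
  using n_ge_2 by (simp add: lift_of_def algebra_simps)

lemma lift_of_nat:
  assumes "length l = n" "sum_list l + cyc_deg n \<nu> = k" "j \<le> n"
  shows "lift_of k l (int j) = val j + int n * height l j"
proof (cases "j = n")
  case True
  have "height l n = int (sum_list l) + int (cyc_deg n \<nu>)"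
    using assms(1) by (simp add: height_def sum.distrib cyc_deg_eq sum_list_sum_nth atLeast0LessThan)
  then show ?thesis
    using True n_ge_2 assms(2) by (simp add: lift_of_def val_n height_def[of _ 0] flip: of_nat_add)
next
  case False
  then show ?thesis using assms(3) by (simp add: lift_of_def)
qed

text \<open>
Residues lie in \<open>{0..<n}\<close>, so increasing from \<open>j\<close> to \<open>Suc j\<close> needs a full extra wrap
precisely when the residue goes down.
\<close>

lemma step_cases:
  fixes a b :: int
  shows "val j + int n * a < val (Suc j) + int n * b \<longleftrightarrow> a + int (desc j) \<le> b"
proof (cases "val (Suc j) < val j")
  case True
  then have desc: "desc j = 1" by (simp add: desc_def)
  show ?thesis
  proof
    assume "val j + int n * a < val (Suc j) + int n * b"
    with True have "int n * a < int n * b" by linarith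
    then show "a + int (desc j) \<le> b"
      using desc n_ge_2 mult_less_cancel_left_pos[of "int n" a b] by simp
  next
    assume "a + int (desc j) \<le> b"
    then have "int n * (a + 1) \<le> int n * b" using desc by (simp add: mult_left_mono del: mult_le_cancel_left)
    then show "val j + int n * a < val (Suc j) + int n * b"
      using val_bounds[of j] val_bounds[of "Suc j"] by (simp add: distrib_left)
  qed
next
  case False
  then have desc: "desc j = 0" and less: "val j < val (Suc j)"
    using val_neq[of j] by (auto simp: desc_def)
  show ?thesis
  proof
    assume *: "val j + int n * a < val (Suc j) + int n * b"
    show "a + int (desc j) \<le> b"
    proof (rule ccontr)
      assume "\<not> a + int (desc j) \<le> b"
      then have "int n * (b + 1) \<le> int n * a" using desc by (intro mult_left_mono) simp_all
      then show False using * val_bounds[of j] val_bounds[of "Suc j"] by (simp add: distrib_left)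
    qed
  next
    assume "a + int (desc j) \<le> b"
    then have "int n * a \<le> int n * b" using desc by (intro mult_left_mono) simp_all
    then show "val j + int n * a < val (Suc j) + int n * b" using less by linarith
  qed
qed

lemma lift_of_in:
  assumes l: "length l = n" "sum_list l + cyc_deg n \<nu> = k"
  shows "lift_of k l \<in> cyclic_lifts n k" "residue_perm n (lift_of k l) = \<nu>"
proof -
  let ?f = "lift_of k l"
  note at_nat = lift_of_nat[OF l]
  have k: "0 < k" using l(2) cyc_deg_pos by simp
  have "?f i < ?f (i + 1)" for i
  proof -
    define a where "a = nat (i mod int n)"
    have a: "a < n" "i = int a + int n * (i div int n)"
      using n_ge_2 by (simp_all add: a_def nat_less_iff)
    define t where "t = i div int n"
    have i: "i = int a + int n * t" "i + 1 = int (Suc a) + int n * t"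
      using a(2) by (simp_all add: t_def)
    have "?f (int a) < ?f (int (Suc a))"
      using a(1) by (simp add: at_nat step_cases height_def del: of_nat_Suc)
    then have "?f (int a + int n * t) < ?f (int (Suc a) + int n * t)"
      unfolding lift_of_shift by simp
    then show ?thesis by (simp only: i(1) i(2)[unfolded i(1)])
  qed
  then have "strict_mono ?f" by (simp add: strict_mono_int_iff_step)
  then interpret degree_lift n k ?f
    using lift_of_shift[of k l _ 1] n_ge_2 k by unfold_locales simp_all
  have mod: "?f (int j) mod int n = val j" if "j < n" for j
    using at_nat[of j] that val_bounds[of j] by simp
  have pow: "int ((\<nu> ^^ m) 1) = (?f ^^ m) 0 mod int n + 1" for m
    by (rule funpow_residue) (simp add: mod val_def)
  note return = n_cycle_return[OF cycle_perm n_pos]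
  have "int n dvd (?f ^^ m) 0 \<longleftrightarrow> (\<nu> ^^ m) 1 = 1" for m
    unfolding dvd_eq_mod_eq_0 using pow[of m] by linarith
  then have "cyclic_lift n k ?f"
    using return by unfold_locales simp_all
  moreover have "?f 0 = val 0" using at_nat[of 0] by (simp add: height_def)
  ultimately show "?f \<in> cyclic_lifts n k" by (simp add: cyclic_lifts_def val_bounds)
  show "residue_perm n ?f = \<nu>"
  proof
    fix i
    show "residue_perm n ?f i = \<nu> i"
    proof (cases "i \<in> {1..n}")
      case True
      then obtain j where j: "i = Suc j" "j < n" by (cases i) auto
      then have "residue_perm n ?f i = nat (val j) + 1"
        using mod[of j] by (simp add: residue_perm_def)
      also have "\<dots> = \<nu> i"
        using val_bounds(1)[of j] j by (simp add: val_def)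
      finally show ?thesis .
    next
      case False
      then show ?thesis using permutes_not_in[OF perm False] by (auto simp: residue_perm_def)
    qed
  qed
qed

lemma lift_values:
  assumes f: "f \<in> cyclic_lifts n k" "residue_perm n f = \<nu>" and "j \<le> n"
  shows "f (int j) = val j + int n * (f (int j) div int n)"
proof -
  interpret cyclic_lift n k f using f by (simp add: cyclic_lifts_def)
  have mod: "f (int j) mod int n = val j" if "j < n" for j
  proof -
    have "int (\<nu> (Suc j)) = f (int j) mod int n + 1"
      using that n_pos unfolding f(2)[symmetric] by (simp add: residue_perm_def)
    then show ?thesis using that by (simp add: val_def)
  qed
  have "f (int j) mod int n = val j"
  proof (cases "j = n")
    case True
    then show ?thesis using period[of 0] mod[of 0] n_pos by (simp add: val_n)
  qed (use mod \<open>j \<le> n\<close> in simp)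
  then show ?thesis by (metis add.commute mult_div_mod_eq)
qed

lemma height_gaps:
  assumes f: "f \<in> cyclic_lifts n k" "residue_perm n f = \<nu>" and "j \<le> n"
  shows "height (gaps f) j = f (int j) div int n"
proof -
  interpret cyclic_lift n k f using f by (simp add: cyclic_lifts_def)
  let ?h = "\<lambda>j. f (int j) div int n"
  have gap: "int (gaps f ! j + desc j) = ?h (Suc j) - ?h j" if "j < n" for j
  proof -
    have "f (int j) < f (int (Suc j))" using mono by (simp add: strict_mono_def)
    then have "?h j + int (desc j) \<le> ?h (Suc j)"
      using lift_values[OF f, of j] lift_values[OF f, of "Suc j"] that step_cases[of j "?h j" "?h (Suc j)"]
      by (simp del: of_nat_Suc)
    moreover have "gaps f ! j = nat (?h (Suc j) - ?h j) - desc j"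
      using that by (simp add: gaps_def del: of_nat_Suc upt_Suc)
    ultimately show ?thesis by linarith
  qed
  have "height (gaps f) j = (\<Sum>i<j. ?h (Suc i) - ?h i)"
    unfolding height_def by (intro sum.cong refl gap) (use \<open>j \<le> n\<close> in simp)
  also have "\<dots> = ?h j - ?h 0"
    by (rule sum_lessThan_telescope)
  also have "?h 0 = 0" using f(1) by (simp add: cyclic_lifts_def)
  finally show ?thesis by simp
qed

lemma gaps_in:
  assumes f: "f \<in> cyclic_lifts n k" "residue_perm n f = \<nu>"
  shows "length (gaps f) = n" "sum_list (gaps f) + cyc_deg n \<nu> = k"
proof -
  interpret cyclic_lift n k f using f by (simp add: cyclic_lifts_def)
  show len: "length (gaps f) = n" by (simp add: gaps_def)
  have "height (gaps f) n = int (sum_list (gaps f)) + int (cyc_deg n \<nu>)"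
    using len by (simp add: height_def sum.distrib cyc_deg_eq sum_list_sum_nth atLeast0LessThan)
  moreover have "f (int n) div int n = int k"
    using period[of 0] f(1) n_pos by (simp add: cyclic_lifts_def)
  ultimately show "sum_list (gaps f) + cyc_deg n \<nu> = k" using height_gaps[OF f, of n] by simp
qed

lemma lift_of_gaps:
  assumes f: "f \<in> cyclic_lifts n k" "residue_perm n f = \<nu>"
  shows "lift_of k (gaps f) = f"
proof
  fix i
  interpret cyclic_lift n k f using f by (simp add: cyclic_lifts_def)
  define a where "a = nat (i mod int n)"
  have a: "a < n" "i = int a + int n * (i div int n)"
    using n_ge_2 by (simp_all add: a_def nat_less_iff)
  have "lift_of k (gaps f) (int a) = val a + int n * height (gaps f) a"
    using lift_of_nat[OF gaps_in[OF f]] a(1) by simp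
  also have "\<dots> = f (int a)"
    using lift_values[OF f, of a] height_gaps[OF f, of a] a(1) by simp
  finally have "lift_of k (gaps f) (int a + int n * (i div int n)) = f (int a + int n * (i div int n))"
    by (simp add: lift_of_shift shift)
  then show "lift_of k (gaps f) i = f i" using a(2) by simp
qed

lemma gaps_lift_of:
  assumes l: "length l = n" "sum_list l + cyc_deg n \<nu> = k"
  shows "gaps (lift_of k l) = l"
proof (rule nth_equalityI)
  show "length (gaps (lift_of k l)) = length l" using l by (simp add: gaps_def)
  fix j assume "j < length (gaps (lift_of k l))"
  then have j: "j < n" by (simp add: gaps_def)
  have div: "lift_of k l (int j) div int n = height l j" if "j \<le> n" for j
    using lift_of_nat[OF l that] val_bounds[of j] n_ge_2 by simp
  have "gaps (lift_of k l) ! j = nat (height l (Suc j) - height l j) - desc j"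
    using j div[of j] div[of "Suc j"] by (simp add: gaps_def del: of_nat_Suc upt_Suc)
  then show "gaps (lift_of k l) ! j = l ! j" by (simp add: height_def)
qed

lemma card_lifts_over:
  "card {f \<in> cyclic_lifts n k. residue_perm n f = \<nu>}
    = card {l. length l = n \<and> sum_list l + cyc_deg n \<nu> = k}"
proof (rule bij_betw_same_card)
  show "bij_betw gaps {f \<in> cyclic_lifts n k. residue_perm n f = \<nu>}
      {l. length l = n \<and> sum_list l + cyc_deg n \<nu> = k}"
  proof (rule bij_betw_byWitness[where f' = "lift_of k"])
    show "gaps ` {f \<in> cyclic_lifts n k. residue_perm n f = \<nu>}
        \<subseteq> {l. length l = n \<and> sum_list l + cyc_deg n \<nu> = k}"
      using gaps_in by blast
    show "lift_of k ` {l. length l = n \<and> sum_list l + cyc_deg n \<nu> = k}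
        \<subseteq> {f \<in> cyclic_lifts n k. residue_perm n f = \<nu>}"
      using lift_of_in by blast
  qed (auto simp: lift_of_gaps gaps_lift_of)
qed

end

section \<open>Inverting the relation between \<open>Delta\<close> and the degree counts\<close>

lemma finite_lists_sum: "finite {l :: nat list. length l = n \<and> sum_list l + d = k}"
proof (rule finite_subset)
  show "{l :: nat list. length l = n \<and> sum_list l + d = k} \<subseteq> {l. set l \<subseteq> {..k} \<and> length l = n}"
    using member_le_sum_list by fastforce
  show "finite {l. set l \<subseteq> {..k} \<and> length l = n}"
    by (rule finite_lists_length_eq) simp
qed

lemma finite_n_cycles: "finite (n_cycles n)"
  by (rule finite_subset[OF _ finite_permutations[of "{1..n}"]]) (auto simp: n_cycles_def)

lemma card_cyclic_lifts_eq_sum: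
  assumes n: "2 \<le> n"
  shows "card (cyclic_lifts n k)
    = (\<Sum>\<nu>\<in>n_cycles n. card {l :: nat list. length l = n \<and> sum_list l + cyc_deg n \<nu> = k})"
proof -
  define fibre where "fibre \<nu> = {f \<in> cyclic_lifts n k. residue_perm n f = \<nu>}" for \<nu>
  have card_fibre: "card (fibre \<nu>) = card {l :: nat list. length l = n \<and> sum_list l + cyc_deg n \<nu> = k}"
    if "\<nu> \<in> n_cycles n" for \<nu>
    unfolding fibre_def using n that by (intro n_cycle.card_lifts_over) unfold_locales
  have "cyclic_lifts n k = (\<Union>\<nu>\<in>n_cycles n. fibre \<nu>)"
    using residue_perm_n_cycle by (fastforce simp: fibre_def cyclic_lifts_def)
  also have "card \<dots> = (\<Sum>\<nu>\<in>n_cycles n. card (fibre \<nu>))"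
  proof (rule card_UN_disjoint)
    show "finite (n_cycles n)" by (rule finite_n_cycles)
    show "\<forall>\<nu>\<in>n_cycles n. finite (fibre \<nu>)"
    proof
      fix \<nu> assume "\<nu> \<in> n_cycles n"
      then interpret n_cycle n \<nu> using n by unfold_locales
      have "fibre \<nu> \<subseteq> lift_of k ` {l. length l = n \<and> sum_list l + cyc_deg n \<nu> = k}"
      proof
        fix f assume "f \<in> fibre \<nu>"
        then have f: "f \<in> cyclic_lifts n k" "residue_perm n f = \<nu>" by (auto simp: fibre_def)
        show "f \<in> lift_of k ` {l. length l = n \<and> sum_list l + cyc_deg n \<nu> = k}"
          using gaps_in[OF f] lift_of_gaps[OF f] by (metis (mono_tags, lifting) imageI mem_Collect_eq)
      qed
      then show "finite (fibre \<nu>)" by (rule finite_subset) (intro finite_imageI finite_lists_sum)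
    qed
  qed (auto simp: fibre_def)
  finally show ?thesis using card_fibre by simp
qed

text \<open>
Both sides count the normalised lifts of degree \<open>k\<close>: the left by rotation number, the right
by the \<open>n\<close>-cycle they induce and then by stars and bars.
\<close>

lemma Delta_eq_convolution:
  assumes n: "2 \<le> n" and k: "0 < k"
  shows "Delta n k = (\<Sum>d\<le>k. int (num_cycles_deg n d) * int ((n + (k - d) - 1) choose (k - d)))"
proof -
  define c where "c d = (n + (k - d) - 1) choose (k - d)" for d
  have count: "card {l :: nat list. length l = n \<and> sum_list l + d = k} = (if d \<le> k then c d else 0)" for d
  proof (cases "d \<le> k")
    case True
    then have "{l :: nat list. length l = n \<and> sum_list l + d = k} = {l. length l = n \<and> sum_list l = k - d}"
      by auto
    then show ?thesis using True by (simp add: card_length_sum_list add.commute c_def)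
  next
    case False
    then have "{l :: nat list. length l = n \<and> sum_list l + d = k} = {}" by auto
    then show ?thesis using False by (simp only: card.empty) simp
  qed
  have "Delta n k = int (\<Sum>\<nu>\<in>n_cycles n. if cyc_deg n \<nu> \<le> k then c (cyc_deg n \<nu>) else 0)"
    using n k by (simp add: card_cyclic_lifts[symmetric] card_cyclic_lifts_eq_sum count)
  also have "(\<Sum>\<nu>\<in>n_cycles n. if cyc_deg n \<nu> \<le> k then c (cyc_deg n \<nu>) else 0)
      = (\<Sum>\<nu>\<in>{\<nu> \<in> n_cycles n. cyc_deg n \<nu> \<in> {..k}}. c (cyc_deg n \<nu>))"
    using finite_n_cycles by (simp add: sum.inter_filter)
  also have "\<dots> = (\<Sum>d\<le>k. \<Sum>\<nu>\<in>{\<nu> \<in> {\<nu> \<in> n_cycles n. cyc_deg n \<nu> \<in> {..k}}. cyc_deg n \<nu> = d}. c (cyc_deg n \<nu>))"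
    by (rule sum.group[symmetric]) (use finite_n_cycles in auto)
  also have "\<dots> = (\<Sum>d\<le>k. num_cycles_deg n d * c d)"
  proof (rule sum.cong)
    fix d assume "d \<in> {..k}"
    then have "{\<nu> \<in> {\<nu> \<in> n_cycles n. cyc_deg n \<nu> \<in> {..k}}. cyc_deg n \<nu> = d} = {\<nu> \<in> n_cycles n. cyc_deg n \<nu> = d}"
      by auto
    then show "(\<Sum>\<nu>\<in>{\<nu> \<in> {\<nu> \<in> n_cycles n. cyc_deg n \<nu> \<in> {..k}}. cyc_deg n \<nu> = d}. c (cyc_deg n \<nu>))
        = num_cycles_deg n d * c d"
      by (simp add: num_cycles_deg_def)
  qed simp
  finally show ?thesis by (simp add: c_def)
qed

lemma one_minus_fps_X_power_nth:
  "fps_nth ((1 - fps_X) ^ n) i = (- 1) ^ i * (of_nat (n choose i) :: 'a :: field_char_0)"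
proof -
  have "(1 - fps_X) ^ n = fps_compose (fps_binomial (of_nat n)) (- fps_const 1 * fps_X :: 'a fps)"
    using one_minus_const_fps_X_power[of "1 :: 'a" n] by simp
  also have "\<dots> = Abs_fps (\<lambda>i. (- 1) ^ i * fps_nth (fps_binomial (of_nat n)) i)"
    unfolding fps_const_neg by (rule fps_compose_linear)
  finally show ?thesis by (simp add: binomial_gbinomial)
qed

text \<open>
The binomials in the hypothesis are the coefficients of \<open>1 / (1 - x) ^ n\<close>; multiply the
generating function by \<open>(1 - x) ^ n\<close>.
\<close>

lemma convolution_inverse:
  fixes a b :: "nat \<Rightarrow> 'a :: field_char_0"
  assumes "0 < n" and "\<And>k. b k = (\<Sum>d\<le>k. a d * of_nat ((n + (k - d) - 1) choose (k - d)))"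
  shows "a d = (\<Sum>k\<le>d. (- 1) ^ (d - k) * of_nat (n choose (d - k)) * b k)"
proof -
  let ?P = "(1 - fps_X) ^ n :: 'a fps"
  have "Abs_fps b = Abs_fps a * inverse ?P"
    using one_minus_const_fps_X_neg_power'[OF assms(1), of "1 :: 'a"]
    by (intro fps_ext) (simp add: assms(2) fps_mult_nth atLeast0AtMost)
  moreover have "?P * inverse ?P = 1"
    by (rule inverse_mult_eq_1') simp
  ultimately have "Abs_fps a = Abs_fps b * ?P"
    by (simp add: mult.assoc mult.commute[of "inverse ?P"])
  then have "fps_nth (Abs_fps a) d = fps_nth (Abs_fps b * ?P) d" by simp
  then show ?thesis
    by (simp add: fps_mult_nth one_minus_fps_X_power_nth atLeast0AtMost mult_ac)
qed

theorem theorem1p1: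
  fixes n d :: nat
  assumes "n \<ge> 2" and "d \<ge> 1"
  shows "int (num_cycles_deg n d) =
    (\<Sum>k = 1..d. (- 1) ^ (d - k) * int (n choose (d - k)) * Delta n k)"
proof -
  define a where "a d = rat_of_nat (num_cycles_deg n d)" for d
  (* The sum of Delta in the theorem starts at 1, and num_cycles_deg n 0 = 0, so the
     convolution identity extends to k = 0 once the term at 0 is replaced by 0. *)
  define b where "b k = (if k = 0 then 0 else rat_of_int (Delta n k))" for k
  have "num_cycles_deg n 0 = 0"
  proof -
    have "0 < cyc_deg n \<nu>" if "\<nu> \<in> n_cycles n" for \<nu>
      using assms(1) that by (intro n_cycle.cyc_deg_pos) unfold_locales
    then have "{\<nu> \<in> n_cycles n. cyc_deg n \<nu> = 0} = {}" by fastforce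
    then show ?thesis by (simp only: num_cycles_deg_def card.empty)
  qed
  then have "b k = (\<Sum>d\<le>k. a d * of_nat ((n + (k - d) - 1) choose (k - d)))" for k
    using Delta_eq_convolution[OF assms(1), of k] by (simp add: a_def b_def)
  with assms(1) have "a d = (\<Sum>k\<le>d. (- 1) ^ (d - k) * of_nat (n choose (d - k)) * b k)"
    by (intro convolution_inverse) simp_all
  also have "\<dots> = (\<Sum>k = 1..d. (- 1) ^ (d - k) * of_nat (n choose (d - k)) * b k)"
    by (rule sum.mono_neutral_right) (auto simp: b_def not_less_eq_eq)
  also have "\<dots> = rat_of_int (\<Sum>k = 1..d. (- 1) ^ (d - k) * int (n choose (d - k)) * Delta n k)"
    unfolding of_int_sum by (intro sum.cong) (auto simp: b_def)
  finally have "rat_of_int (int (num_cycles_deg n d))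
      = rat_of_int (\<Sum>k = 1..d. (- 1) ^ (d - k) * int (n choose (d - k)) * Delta n k)"
    by (simp only: a_def of_int_of_nat_eq)
  then show ?thesis by (simp only: of_int_eq_iff)
qed

end
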